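(* Let $I\subset\mathbb{R}$ be an interval with interior $I^\circ$, let $a,b\in I$ with $0\le a<b$, and let $f:I\to\mathbb{R}$ be a twice differentiable function on $I^\circ$ with $f'\in L_1[a,b]$. Let $\alpha\ge1$ and $0\le\lambda\le1$. Then, for $x\in[a,b]$, the following identity holds: $$(1-2\lambda)f(x)=\frac{\Gamma(\alpha)}{b-a}(b-x)^{1-\alpha}J_a^{\alpha}f(b)-\lambda\left(\frac{b-a}{b-x}\right)^{\alpha-1}f(a)-J_a^{\alpha-1}\big(P_3(x,b)f(b)\big)+J_a^{\alpha}\big(P_3(x,b)f'(b)\big),$$ where $P_3(x,t)$ is the fractional Peano kernel defined by $$P_3(x,t)=\begin{cases}\dfrac{t-(1-\lambda)a-\lambda b}{b-a}(b-x)^{1-\alpha}\,\Gamma(\alpha), & a\le t<x,\\[2mm] \dfrac{t-(1-\lambda)b-\lambda a}{b-a}(b-x)^{1-\alpha}\,\Gamma(\alpha), & x\le t\le b.\end{cases}$$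
   Context: For $\beta\ge 0$ and $a\ge0$ the Riemann-Liouville fractional integral is $J_a^{\beta}g(y)=\frac{1}{\Gamma(\beta)}\int_a^y (y-t)^{\beta-1}g(t)\,dt$ if $\beta>0$, and $J_a^0g(y)=g(y)$. The notation $J_a^{\beta}(P_3(x,b)g(b))$ means $J_a^\beta$ applied to the function $t\mapsto P_3(x,t)g(t)$ and evaluated at $b$ (with $x$ fixed): for $\beta>0$ it equals $\frac{1}{\Gamma(\beta)}\int_a^b (b-t)^{\beta-1}P_3(x,t)g(t)\,dt$, and for $\beta=0$ it equals $P_3(x,b)g(b)$.
   Formalization: Continuity of f on [a,b] is added (at an endpoint of I the identity can fail: f=0 on (a,b], f(a)=1, α=1, λ>0, a<x<b gives 0=-λ), and x=b is allowed only for α=1, since (b-x)^{1-α} and ((b-a)/(b-x))^{α-1} are undefined at x=b when α>1. *)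

theory Defs
  imports "HOL-Analysis.Analysis"
begin

text \<open>
  The library has \<open>0 powr 0 = 0\<close>. The powers below follow the convention that exponent \<open>0\<close>
  always gives \<open>1\<close>, so that \<open>(b - x) ^ (1 - \<alpha>)\<close> is \<open>1\<close> for \<open>\<alpha> = 1\<close> even at \<open>x = b\<close>.
\<close>

definition rpow :: "real \<Rightarrow> real \<Rightarrow> real" where
  "rpow u p = (if p = 0 then 1 else u powr p)"

text \<open>
  Only orders \<open>\<beta> \<ge> 0\<close> and points \<open>y \<ge> a\<close> are meaningful.
  The plain \<open>powr\<close> suffices in the integrand: it differs from \<open>rpow\<close> at most at \<open>t = y\<close>.
\<close>

definition RL_integral :: "real \<Rightarrow> real \<Rightarrow> (real \<Rightarrow> real) \<Rightarrow> real \<Rightarrow> real" where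
  "RL_integral a \<beta> g y =
     (if \<beta> = 0 then g y
      else 1 / Gamma \<beta> * (LINT t:{a..y}|lebesgue. (y - t) powr (\<beta> - 1) * g t))"

definition peano_kernel :: "real \<Rightarrow> real \<Rightarrow> real \<Rightarrow> real \<Rightarrow> real \<Rightarrow> real \<Rightarrow> real" where
  "peano_kernel a b \<alpha> l x t =
     (if t < x then (t - (1 - l) * a - l * b) / (b - a) * rpow (b - x) (1 - \<alpha>) * Gamma \<alpha>
      else (t - (1 - l) * b - l * a) / (b - a) * rpow (b - x) (1 - \<alpha>) * Gamma \<alpha>)"

end

theory Submission
  imports Defs
begin

text \<open>
  The identity is one integration by parts. Let \<open>K\<close> be the kernel without its constant
  factors, that is \<open>K t = (t - p) / (b - a)\<close> left of \<open>x\<close> and \<open>K t = (t - q) / (b - a)\<close> right of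
  it, where \<open>p = (1 - l) a + l b\<close> and \<open>q = (1 - l) b + l a\<close>. On each of the two pieces the
  product rule gives
  \<open>((b - t)\<^sup>\<alpha>\<^sup>-\<^sup>1 K f)' = (b - t)\<^sup>\<alpha>\<^sup>-\<^sup>1 f / (b - a) + (b - t)\<^sup>\<alpha>\<^sup>-\<^sup>1 K f' - (\<alpha> - 1) (b - t)\<^sup>\<alpha>\<^sup>-\<^sup>2 K f\<close>,
  and after multiplication by \<open>(b - x)\<^sup>1\<^sup>-\<^sup>\<alpha>\<close> the three terms on the right are, up to
  constants, the integrands of the three fractional integrals, with
  \<open>\<Gamma>(\<alpha>) = (\<alpha> - 1) \<Gamma>(\<alpha> - 1)\<close>. The jump \<open>(q - p) / (b - a) = 1 - 2 l\<close> of \<open>- K\<close> at \<open>x\<close> produces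
  \<open>(1 - 2 l) f x\<close>, and the value \<open>- l\<close> of the left branch at \<open>a\<close> produces the term with \<open>f a\<close>.
  The end point \<open>b\<close> contributes nothing for \<open>\<alpha> > 1\<close>; for \<open>\<alpha> = 1\<close> it contributes \<open>l f(b)\<close>, which is
  what the integral of order \<open>0\<close> degenerates to.

  The fundamental theorem of calculus for the Henstock--Kurzweil integral
  (\<open>rpow_integration_by_parts\<close>) asks only for continuity up to the end points and a derivative
  inside, so neither the singularity of \<open>(b - t)\<^sup>\<alpha>\<^sup>-\<^sup>2\<close> at \<open>b\<close> nor the missing derivatives of \<open>f\<close> at
  \<open>a\<close> and \<open>b\<close> does harm. To separate the three terms, and to read each as a Lebesgue integral
  (\<open>RL_integral_eq_integral\<close>), each must be absolutely integrable: it is the product of the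
  integrable factor \<open>(b - t)\<^sup>\<alpha>\<^sup>-\<^sup>1\<close>, \<open>(b - t)\<^sup>\<alpha>\<^sup>-\<^sup>2\<close> (for \<open>\<alpha> > 1\<close>) or \<open>f'\<close> with a bounded
  measurable one.
\<close>

section \<open>Powers of the distance to the right end point\<close>

lemma rpow_eq_powr: "0 < u \<Longrightarrow> rpow u p = u powr p"
  by (simp add: rpow_def)

lemma rpow_nonneg: "0 \<le> rpow u p"
  by (simp add: rpow_def)

lemma has_real_derivative_rpow_diff:
  assumes "t < b"
  shows "((\<lambda>t. rpow (b - t) p) has_real_derivative - (p * rpow (b - t) (p - 1))) (at t)"
proof -
  have "((\<lambda>t. (b - t) powr p) has_real_derivative - (p * rpow (b - t) (p - 1))) (at t)"
    using assms by (auto intro!: derivative_eq_intros simp: rpow_eq_powr)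
  then show ?thesis
    by (rule has_field_derivative_transform_within_open [where S = "{..<b}"])
       (use assms in \<open>auto simp: rpow_eq_powr\<close>)
qed

lemma continuous_on_rpow_diff:
  assumes "0 \<le> p"
  shows "continuous_on {..b} (\<lambda>t. rpow (b - t) p)"
proof (cases "p = 0")
  case False
  have "continuous_on {..b} (\<lambda>t. (b - t) powr p)"
    by (rule continuous_on_powr') (use assms False in \<open>auto intro!: continuous_intros\<close>)
  then show ?thesis
    using False by (simp add: rpow_def)
qed (simp add: rpow_def)

text \<open>
  The left-hand side is the derivative of \<open>rpow (b - t) p * h t\<close>. Stating it for arbitrary
  \<open>u\<close>, \<open>v\<close> and \<open>h\<close> serves both for the two pieces of the kernel and, with \<open>h = 1\<close>, for the
  integrability of the powers themselves.
\<close>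

lemma rpow_integration_by_parts:
  fixes h h' :: "real \<Rightarrow> real"
  assumes "u \<le> v" "v \<le> b" "0 \<le> p"
    and cont: "continuous_on {u..v} h"
    and deriv: "\<And>t. u < t \<Longrightarrow> t < v \<Longrightarrow> (h has_real_derivative h' t) (at t)"
  shows "((\<lambda>t. rpow (b - t) p * h' t - p * (rpow (b - t) (p - 1) * h t)) has_integral
           rpow (b - v) p * h v - rpow (b - u) p * h u) {u..v}"
proof (rule fundamental_theorem_of_calculus_interior [OF \<open>u \<le> v\<close>])
  have "continuous_on {u..v} (\<lambda>t. rpow (b - t) p)"
    by (rule continuous_on_subset [OF continuous_on_rpow_diff]) (use assms in auto)
  then show "continuous_on {u..v} (\<lambda>t. rpow (b - t) p * h t)"
    using cont by (rule continuous_on_mult)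
next
  fix t assume t: "t \<in> {u<..<v}"
  then have "((\<lambda>t. rpow (b - t) p * h t) has_real_derivative
      - (p * rpow (b - t) (p - 1)) * h t + h' t * rpow (b - t) p) (at t)"
    using \<open>v \<le> b\<close> by (intro DERIV_mult has_real_derivative_rpow_diff deriv) auto
  then show "((\<lambda>t. rpow (b - t) p * h t) has_vector_derivative
      rpow (b - t) p * h' t - p * (rpow (b - t) (p - 1) * h t)) (at t)"
    by (simp add: has_real_derivative_iff_has_vector_derivative algebra_simps)
qed

lemma rpow_diff_absolutely_integrable:
  assumes "a \<le> b" "-1 < p"
  shows "(\<lambda>t. rpow (b - t) p) absolutely_integrable_on {a..b}"
proof (rule nonnegative_absolutely_integrable_1)
  have "((\<lambda>t. rpow (b - t) (p + 1) * 0 - (p + 1) * (rpow (b - t) (p + 1 - 1) * 1)) has_integral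
      rpow (b - b) (p + 1) * 1 - rpow (b - a) (p + 1) * 1) {a..b}"
    using assms by (intro rpow_integration_by_parts [where h = "\<lambda>_. 1"]) auto
  then have "(\<lambda>t. (- inverse (p + 1)) * (- ((p + 1) * rpow (b - t) p))) integrable_on {a..b}"
    by (intro integrable_on_mult_right) (auto simp: integrable_on_def)
  then show "(\<lambda>t. rpow (b - t) p) integrable_on {a..b}"
    using assms by simp
qed (rule rpow_nonneg)

section \<open>Fractional integrals as Henstock--Kurzweil integrals\<close>

text \<open>The two integrands may differ at \<open>t = b\<close>, which is a null set.\<close>

lemma RL_integral_eq_integral:
  assumes "\<beta> > 0"
    and int: "(\<lambda>t. rpow (b - t) (\<beta> - 1) * g t) absolutely_integrable_on {a..b}"
  shows "RL_integral a \<beta> g b = integral {a..b} (\<lambda>t. rpow (b - t) (\<beta> - 1) * g t) / Gamma \<beta>"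
proof -
  let ?g = "\<lambda>t. (b - t) powr (\<beta> - 1) * g t"
  have eq: "?g t = rpow (b - t) (\<beta> - 1) * g t" if "t \<in> {a..b} - {b}" for t
    using that rpow_eq_powr [of "b - t" "\<beta> - 1"] by auto
  have "?g absolutely_integrable_on {a..b}"
    by (rule absolutely_integrable_spike [OF int negligible_sing eq])
  then have "(LINT t:{a..b}|lebesgue. ?g t) = integral {a..b} ?g"
    by (rule set_lebesgue_integral_eq_integral)
  also have "\<dots> = integral {a..b} (\<lambda>t. rpow (b - t) (\<beta> - 1) * g t)"
    by (rule integral_spike [OF negligible_sing eq [symmetric]])
  finally show ?thesis
    using \<open>\<beta> > 0\<close> by (simp add: RL_integral_def)
qed

lemma absolutely_integrable_mult_bounded:
  fixes g k :: "real \<Rightarrow> real"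
  assumes "g absolutely_integrable_on {a..b}"
    and "k \<in> borel_measurable (lebesgue_on {a..b})" and "bounded (k ` {a..b})"
  shows "(\<lambda>t. g t * k t) absolutely_integrable_on {a..b}"
  using absolutely_integrable_bounded_measurable_product_real [OF assms(2) _ assms(3,1)]
  by (simp add: mult.commute)

lemma absolutely_integrable_mult_continuous:
  fixes g k :: "real \<Rightarrow> real"
  assumes "g absolutely_integrable_on {a..b}" and "continuous_on {a..b} k"
  shows "(\<lambda>t. g t * k t) absolutely_integrable_on {a..b}"
  using assms by (intro absolutely_integrable_mult_bounded)
    (auto intro!: continuous_imp_measurable_on_sets_lebesgue compact_imp_bounded
      compact_continuous_image)

section \<open>The kernel without its constant factors\<close>

definition reduced_kernel :: "real \<Rightarrow> real \<Rightarrow> real \<Rightarrow> real \<Rightarrow> real \<Rightarrow> real" where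
  "reduced_kernel a b l x t =
     (t - (if t < x then (1 - l) * a + l * b else (1 - l) * b + l * a)) / (b - a)"

lemma peano_kernel_eq_reduced_kernel:
  "peano_kernel a b \<alpha> l x t = rpow (b - x) (1 - \<alpha>) * Gamma \<alpha> * reduced_kernel a b l x t"
  by (simp add: peano_kernel_def reduced_kernel_def algebra_simps)

lemma absolutely_integrable_mult_reduced_kernel:
  assumes "g absolutely_integrable_on {a..b}"
  shows "(\<lambda>t. g t * reduced_kernel a b l x t) absolutely_integrable_on {a..b}"
proof (rule absolutely_integrable_mult_bounded [OF assms])
  have "reduced_kernel a b l x \<in> borel_measurable borel"
    unfolding reduced_kernel_def by measurable
  then show "reduced_kernel a b l x \<in> borel_measurable (lebesgue_on {a..b})"
    by (intro measurable_restrict_space1) (simp add: borel_measurable_if_D measurable_completion)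
  let ?k = "\<lambda>c t. (t - c) * inverse (b - a)"
  let ?p = "(1 - l) * a + l * b" and ?q = "(1 - l) * b + l * a"
  have "compact (?k c ` {a..b})" for c
    by (intro compact_continuous_image continuous_intros compact_Icc)
  then have "bounded (?k ?p ` {a..b} \<union> ?k ?q ` {a..b})"
    by (auto intro!: compact_imp_bounded)
  moreover have "reduced_kernel a b l x t = ?k ?p t \<or> reduced_kernel a b l x t = ?k ?q t" for t
    by (simp add: reduced_kernel_def divide_inverse)
  then have "reduced_kernel a b l x ` {a..b} \<subseteq> ?k ?p ` {a..b} \<union> ?k ?q ` {a..b}"
    by blast
  ultimately show "bounded (reduced_kernel a b l x ` {a..b})"
    by (rule bounded_subset)
qed

text \<open>
  The integration by parts is done on \<open>[a, x]\<close> and \<open>[x, b]\<close> separately, as the kernel jumps at \<open>x\<close>.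
  The last boundary term comes from the end point \<open>b\<close>; as \<open>rpow 0 p\<close> is \<open>1\<close> for \<open>p = 0\<close> and \<open>0\<close>
  for \<open>p > 0\<close>, one formula covers the classical and the properly fractional case.
\<close>

lemma reduced_kernel_integration_by_parts:
  fixes f f' :: "real \<Rightarrow> real" and a b l x p :: real
  assumes "a < b" "x \<in> {a..b}" "0 \<le> p"
    and cont: "continuous_on {a..b} f"
    and deriv: "\<And>t. a < t \<Longrightarrow> t < b \<Longrightarrow> (f has_real_derivative f' t) (at t)"
  defines "K \<equiv> reduced_kernel a b l x"
  shows "((\<lambda>t. rpow (b - t) p * (f t / (b - a) + K t * f' t) - p * (rpow (b - t) (p - 1) * (K t * f t)))
          has_integral
            (1 - 2 * l) * rpow (b - x) p * f x + l * rpow (b - a) p * f a + l * rpow 0 p * f b) {a..b}"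
    (is "(?F has_integral _) _")
proof -
  have part: "((\<lambda>t. rpow (b - t) p * (f t / (b - a) + (t - c) / (b - a) * f' t)
        - p * (rpow (b - t) (p - 1) * ((t - c) / (b - a) * f t))) has_integral
      rpow (b - v) p * ((v - c) / (b - a) * f v) - rpow (b - u) p * ((u - c) / (b - a) * f u)) {u..v}"
    if "a \<le> u" "u \<le> v" "v \<le> b" for c u v
  proof (rule rpow_integration_by_parts)
    show "continuous_on {u..v} (\<lambda>t. (t - c) / (b - a) * f t)"
      using that \<open>a < b\<close> by (intro continuous_intros continuous_on_subset [OF cont]) auto
    show "((\<lambda>t. (t - c) / (b - a) * f t) has_real_derivative
        f t / (b - a) + (t - c) / (b - a) * f' t) (at t)" if "u < t" "t < v" for t
      using that \<open>a \<le> u\<close> \<open>v \<le> b\<close> \<open>a < b\<close>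
      by (auto intro!: derivative_eq_intros deriv simp: add_divide_distrib mult.commute)
  qed (use that \<open>0 \<le> p\<close> in auto)
  define c\<^sub>1 where "c\<^sub>1 = (1 - l) * a + l * b"
  define c\<^sub>2 where "c\<^sub>2 = (1 - l) * b + l * a"
  have "(?F has_integral rpow (b - x) p * ((x - c\<^sub>1) / (b - a) * f x)
      - rpow (b - a) p * ((a - c\<^sub>1) / (b - a) * f a)) {a..x}"
    by (rule has_integral_spike_finite [OF _ _ part [of a x c\<^sub>1], of "{x}"])
       (use assms(1,2) in \<open>auto simp: K_def reduced_kernel_def c\<^sub>1_def\<close>)
  moreover have "(?F has_integral rpow (b - b) p * ((b - c\<^sub>2) / (b - a) * f b)
      - rpow (b - x) p * ((x - c\<^sub>2) / (b - a) * f x)) {x..b}"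
    by (rule has_integral_eq [OF _ part [of x b c\<^sub>2]])
       (use assms(1,2) in \<open>auto simp: K_def reduced_kernel_def c\<^sub>2_def\<close>)
  ultimately have *: "(?F has_integral
      (rpow (b - x) p * ((x - c\<^sub>1) / (b - a) * f x) - rpow (b - a) p * ((a - c\<^sub>1) / (b - a) * f a))
      + (rpow (b - b) p * ((b - c\<^sub>2) / (b - a) * f b) - rpow (b - x) p * ((x - c\<^sub>2) / (b - a) * f x)))
      {a..b}"
    using assms(2) by (intro has_integral_combine) auto
  define z where "z = (x - c\<^sub>2) / (b - a)"
  have a: "(a - c\<^sub>1) / (b - a) = - l" and b: "(b - c\<^sub>2) / (b - a) = l"
    and x: "(x - c\<^sub>1) / (b - a) = (1 - 2 * l) + z"
    using \<open>a < b\<close> by (simp_all add: z_def c\<^sub>1_def c\<^sub>2_def field_simps)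
  show ?thesis
    by (rule has_integral_eq_rhs [OF *])
       (simp only: a b x z_def [symmetric] diff_self, simp add: algebra_simps)
qed

section \<open>The identity\<close>

theorem theorem3:
  fixes I :: "real set" and f :: "real \<Rightarrow> real" and a b \<alpha> l x :: real
  assumes "is_interval I"
    and "a \<in> I" and "b \<in> I" and "0 \<le> a" and "a < b"
    and "f differentiable_on interior I"
    and "deriv f differentiable_on interior I"
    and "continuous_on {a..b} f"
    and "deriv f absolutely_integrable_on {a..b}"
    and "1 \<le> \<alpha>"
    and "0 \<le> l" and "l \<le> 1"
    and "x \<in> {a..b}"
    and "x = b \<longrightarrow> \<alpha> = 1"
  shows "(1 - 2 * l) * f x =
      Gamma \<alpha> / (b - a) * rpow (b - x) (1 - \<alpha>) * RL_integral a \<alpha> f b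
      - l * rpow ((b - a) / (b - x)) (\<alpha> - 1) * f a
      - RL_integral a (\<alpha> - 1) (\<lambda>t. peano_kernel a b \<alpha> l x t * f t) b
      + RL_integral a \<alpha> (\<lambda>t. peano_kernel a b \<alpha> l x t * deriv f t) b"
proof -
  have deriv_f: "(f has_real_derivative deriv f t) (at t)" if "a < t" "t < b" for t
  proof -
    have "{a..b} \<subseteq> I"
      using mem_is_interval_1_I [OF \<open>is_interval I\<close> \<open>a \<in> I\<close> \<open>b \<in> I\<close>] by auto
    from interior_mono [OF this] have "t \<in> interior I"
      using that by (auto simp: interior_atLeastAtMost_real)
    then have "f differentiable (at t)"
      using \<open>f differentiable_on interior I\<close>
      by (simp add: differentiable_on_eq_differentiable_at)
    then show ?thesis
      by (simp add: DERIV_deriv_iff_real_differentiable)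
  qed
  define K where "K = reduced_kernel a b l x"
  define c where "c = rpow (b - x) (1 - \<alpha>)"
  define w where "w = (\<lambda>t. rpow (b - t) (\<alpha> - 1))"
  define w' where "w' = (\<lambda>t. rpow (b - t) (\<alpha> - 1 - 1))"
  have P: "peano_kernel a b \<alpha> l x t = c * Gamma \<alpha> * K t" for t
    by (simp add: peano_kernel_eq_reduced_kernel c_def K_def)
  have Gamma_nz: "Gamma \<alpha> \<noteq> 0"
    using Gamma_real_pos [of \<alpha>] \<open>1 \<le> \<alpha>\<close> by linarith
  have cont_w: "continuous_on {a..b} w"
    unfolding w_def by (rule continuous_on_subset [OF continuous_on_rpow_diff]) (use \<open>1 \<le> \<alpha>\<close> in auto)

  have int_f: "(\<lambda>t. w t * f t) absolutely_integrable_on {a..b}"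
    unfolding w_def using \<open>a < b\<close> \<open>1 \<le> \<alpha>\<close> \<open>continuous_on {a..b} f\<close>
    by (intro absolutely_integrable_mult_continuous rpow_diff_absolutely_integrable) simp_all
  have int_Kf': "(\<lambda>t. w t * (K t * deriv f t)) absolutely_integrable_on {a..b}"
    using absolutely_integrable_mult_reduced_kernel
      [OF absolutely_integrable_mult_continuous [OF \<open>deriv f absolutely_integrable_on {a..b}\<close> cont_w], of l x]
    by (simp add: K_def mult_ac)
  have int_Kf: "(\<lambda>t. w' t * (K t * f t)) absolutely_integrable_on {a..b}" if "\<alpha> > 1"
  proof -
    have "w' absolutely_integrable_on {a..b}"
      unfolding w'_def using that \<open>a < b\<close> by (intro rpow_diff_absolutely_integrable) auto
    from absolutely_integrable_mult_reduced_kernel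
      [OF absolutely_integrable_mult_continuous [OF this \<open>continuous_on {a..b} f\<close>], of l x]
    show ?thesis
      by (simp add: K_def mult_ac)
  qed
  \<comment> \<open>For \<open>\<alpha> = 1\<close> the power \<open>w'\<close> is not integrable; only its product with \<open>\<alpha> - 1\<close> is, being \<open>0\<close>.\<close>
  have int_\<alpha>Kf: "(\<lambda>t. (\<alpha> - 1) * (w' t * (K t * f t))) integrable_on {a..b}"
  proof (cases "\<alpha> = 1")
    case False
    then show ?thesis
      using \<open>1 \<le> \<alpha>\<close>
      by (intro integrable_on_mult_right set_lebesgue_integral_eq_integral(1) int_Kf) simp
  qed (simp add: integrable_0)

  define A where "A = integral {a..b} (\<lambda>t. w t * f t)"
  define B where "B = integral {a..b} (\<lambda>t. (\<alpha> - 1) * (w' t * (K t * f t)))"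
  define C where "C = integral {a..b} (\<lambda>t. w t * (K t * deriv f t))"
  have "((\<lambda>t. (w t * f t) / (b - a) + w t * (K t * deriv f t) - (\<alpha> - 1) * (w' t * (K t * f t)))
      has_integral A / (b - a) + C - B) {a..b}"
    unfolding A_def B_def C_def
    by (intro has_integral_diff has_integral_add has_integral_divide integrable_integral
      set_lebesgue_integral_eq_integral(1) [OF int_f] int_\<alpha>Kf
      set_lebesgue_integral_eq_integral(1) [OF int_Kf'])
  moreover have "((\<lambda>t. (w t * f t) / (b - a) + w t * (K t * deriv f t) - (\<alpha> - 1) * (w' t * (K t * f t)))
      has_integral (1 - 2 * l) * w x * f x + l * w a * f a + l * w b * f b) {a..b}"
    using reduced_kernel_integration_by_parts
      [OF \<open>a < b\<close> \<open>x \<in> {a..b}\<close> _ \<open>continuous_on {a..b} f\<close> deriv_f, of "\<alpha> - 1" l] \<open>1 \<le> \<alpha>\<close>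
    by (simp add: w_def w'_def K_def distrib_left)
  ultimately have parts:
    "A / (b - a) + C - B = (1 - 2 * l) * w x * f x + l * w a * f a + l * w b * f b"
    by (rule has_integral_unique)

  have cwx: "c * w x = 1"
    using assms by (cases "x = b") (auto simp: c_def w_def rpow_def powr_add [symmetric])
  have cwa: "c * w a = rpow ((b - a) / (b - x)) (\<alpha> - 1)"
  proof (cases "\<alpha> = 1")
    case False
    have "((b - a) / (b - x)) powr (\<alpha> - 1) = (b - a) powr (\<alpha> - 1) / (b - x) powr (\<alpha> - 1)"
      by (rule powr_divide)
    then show ?thesis
      using False powr_minus [of "b - x" "\<alpha> - 1"]
      by (simp add: c_def w_def rpow_def divide_inverse mult.commute)
  qed (simp add: c_def w_def rpow_def)
  have RL_f: "RL_integral a \<alpha> f b = A / Gamma \<alpha>"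
    using int_f \<open>1 \<le> \<alpha>\<close> by (simp add: RL_integral_eq_integral A_def w_def)
  have RL_Kf': "RL_integral a \<alpha> (\<lambda>t. peano_kernel a b \<alpha> l x t * deriv f t) b = c * C"
  proof -
    have eq: "(\<lambda>t. rpow (b - t) (\<alpha> - 1) * (peano_kernel a b \<alpha> l x t * deriv f t))
        = (\<lambda>t. (c * Gamma \<alpha>) * (w t * (K t * deriv f t)))"
      by (simp add: P w_def mult_ac)
    have "(\<lambda>t. (c * Gamma \<alpha>) * (w t * (K t * deriv f t))) absolutely_integrable_on {a..b}"
      by (rule set_integrable_mult_right) (rule int_Kf')
    then show ?thesis
      using \<open>1 \<le> \<alpha>\<close> Gamma_nz by (simp add: RL_integral_eq_integral eq C_def)
  qed
  \<comment> \<open>At most one summand survives: \<open>B\<close> vanishes for \<open>\<alpha> = 1\<close>, the boundary value \<open>w b\<close> for \<open>\<alpha> > 1\<close>.\<close>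
  have RL_Kf: "RL_integral a (\<alpha> - 1) (\<lambda>t. peano_kernel a b \<alpha> l x t * f t) b
      = c * (B + l * w b * f b)"
  proof (cases "\<alpha> = 1")
    case True
    have "K b = l"
      using \<open>a < b\<close> \<open>x \<in> {a..b}\<close> by (simp add: K_def reduced_kernel_def field_simps)
    then have "peano_kernel a b \<alpha> l x b = c * l"
      using P [of b] True by simp
    then show ?thesis
      using True by (simp add: RL_integral_def B_def w_def rpow_def)
  next
    case False
    then have \<alpha>: "\<alpha> > 1"
      using \<open>1 \<le> \<alpha>\<close> by simp
    have eq: "(\<lambda>t. rpow (b - t) (\<alpha> - 1 - 1) * (peano_kernel a b \<alpha> l x t * f t))
        = (\<lambda>t. (c * Gamma \<alpha>) * (w' t * (K t * f t)))"
      by (simp add: P w'_def mult_ac)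
    have "(\<lambda>t. (c * Gamma \<alpha>) * (w' t * (K t * f t))) absolutely_integrable_on {a..b}"
      by (rule set_integrable_mult_right) (rule int_Kf [OF \<alpha>])
    then have "RL_integral a (\<alpha> - 1) (\<lambda>t. peano_kernel a b \<alpha> l x t * f t) b
        = c * Gamma \<alpha> * integral {a..b} (\<lambda>t. w' t * (K t * f t)) / Gamma (\<alpha> - 1)"
      using \<alpha> by (subst RL_integral_eq_integral) (unfold eq, simp_all)
    moreover have "Gamma \<alpha> = (\<alpha> - 1) * Gamma (\<alpha> - 1)"
      using Gamma_plus1 [of "\<alpha> - 1"] \<alpha> by (fastforce dest: nonpos_Ints_nonpos)
    moreover have "Gamma (\<alpha> - 1) \<noteq> 0"
      using Gamma_real_pos [of "\<alpha> - 1"] \<alpha> by linarith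
    moreover have "w b = 0"
      using \<alpha> by (simp add: w_def rpow_def)
    ultimately show ?thesis
      by (simp add: B_def)
  qed

  have "(1 - 2 * l) * f x = (1 - 2 * l) * (c * w x) * f x"
    by (simp add: cwx)
  also have "\<dots> = c * (A / (b - a) + C - B) - l * (c * w a) * f a - l * c * w b * f b"
    unfolding parts by (simp add: algebra_simps)
  finally show ?thesis
    unfolding RL_f RL_Kf' RL_Kf cwa c_def [symmetric]
    using Gamma_nz by (simp add: algebra_simps)
qed

end
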